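(* Let $n\ge 2$ and let $K\subset\mathbb{R}^n$ be a generalized Orlicz ball of volume $1$ in isotropic position. Let $X=(X_1,\dots,X_n)$ be uniformly distributed on $K$. Let $f,g:\mathbb{R}\to\mathbb{R}$ be symmetric (i.e. even) functions that are non-decreasing on $[0,\infty)$. Then for all $i\ne j$, $$\operatorname{cov}(f(X_i),g(X_j))\le 0.$$
   Context: A generalized Orlicz ball in $\mathbb{R}^n$ is a set of the form $K=\{x\in\mathbb{R}^n:\sum_{i=1}^n f_i(|x_i|)\le 1\}$, where $f_1,\dots,f_n:[0,\infty)\to[0,\infty)$ (the Young functions) are convex, (strictly) increasing and satisfy $f_i(0)=0$. $K$ of volume $1$ is in isotropic position if, for $X$ uniformly distributed on $K$, $\mathbb{E}X_i=0$ and $\mathbb{E}X_iX_j=L_K^2\delta_{ij}$ for all $i,j$, for some constant $L_K>0$. $\operatorname{cov}(U,V)=\mathbb{E}(UV)-\mathbb{E}U\,\mathbb{E}V$. *)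

theory Defs
  imports "HOL-Probability.Probability"
begin

(* A Young function is a function on [0,\<infinity>); it is represented by a total function on
   the reals of which only the values on {0..} matter. *)
definition young_function :: "(real \<Rightarrow> real) \<Rightarrow> bool" where
  "young_function f \<longleftrightarrow>
     (\<forall>x\<ge>0. f x \<ge> 0) \<and> convex_on {0..} f \<and> strict_mono_on {0..} f \<and> f 0 = 0"

definition generalized_orlicz_ball :: "(real ^ 'n) set \<Rightarrow> bool" where
  "generalized_orlicz_ball K \<longleftrightarrow>
     (\<exists>f :: 'n \<Rightarrow> real \<Rightarrow> real. (\<forall>i. young_function (f i)) \<and>
        K = {x. (\<Sum>i\<in>UNIV. f i \<bar>x $ i\<bar>) \<le> 1})"

(* The expectations are those of the coordinates of the identity under the uniform
   distribution on K. Volume 1 is part of the notion. *)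
definition isotropic_position :: "(real ^ 'n) set \<Rightarrow> bool" where
  "isotropic_position K \<longleftrightarrow>
     emeasure lborel K = 1 \<and>
     (\<forall>i. (LINT x|uniform_measure lborel K. x $ i) = 0) \<and>
     (\<exists>L>0. \<forall>i j. (LINT x|uniform_measure lborel K. x $ i * x $ j) = (if i = j then L\<^sup>2 else 0))"

(* The covariance is meant for U, V and U * V integrable. The Bochner integral is 0 on
   non-integrable functions; this default is not reached for functions of the coordinates
   of a random vector in a generalized Orlicz ball that are even and monotone on {0..},
   because they are Borel and the ball is bounded. *)
definition covariance :: "'a measure \<Rightarrow> ('a \<Rightarrow> real) \<Rightarrow> ('a \<Rightarrow> real) \<Rightarrow> real" where
  "covariance M U V =
     (LINT \<omega>|M. U \<omega> * V \<omega>) - (LINT \<omega>|M. U \<omega>) * (LINT \<omega>|M. V \<omega>)"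

end

theory Submission
  imports Defs
begin

text \<open>
  Fix the coordinates \<open>x\<close> and \<open>y\<close> numbered \<open>i\<close> and \<open>j\<close>, and integrate out the others. The joint
  density of the two is \<open>P x y = V (1 - \<phi> i \<bar>x\<bar> - \<phi> j \<bar>y\<bar>)\<close>, where \<open>V s\<close> is the volume of the set on
  which the Young functions of the remaining coordinates add up to at most \<open>s\<close>. The point is that
  \<open>V\<close> is log-concave. Then, for \<open>\<bar>x\<bar> \<le> \<bar>x'\<bar>\<close> and \<open>\<bar>y\<bar> \<le> \<bar>y'\<bar>\<close>, the density satisfies
  \<open>P x y * P x' y' \<le> P x y' * P x' y\<close>: the moduli tend to be large in opposite coordinates.
  Two applications of Chebyshev's association argument turn this into
  \<open>E (u v) * E 1 \<le> E u * E v\<close> for all \<open>u\<close> and \<open>v\<close> that increase with the modulus of the first and the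
  second coordinate (\<open>negative_dependence_nn_integral\<close>), and this is the sign of the covariance.
  
  Log-concavity is an instance of the Brunn-Minkowski inequality, but the form of the ball makes
  one dimension enough. Adding a coordinate replaces \<open>V\<close> by the integral of
  \<open>V (s - \<phi> k \<bar>x\<bar>)\<close> over \<open>x\<close> (\<open>sublevel_volume_insert\<close>). If \<open>V\<close> is log-concave and increasing and
  \<open>\<phi> k\<close> is convex, the integrand is jointly log-concave in \<open>s\<close> and \<open>\<bar>x\<bar>\<close>, so the one-dimensional
  Prekopa-Leindler inequality preserves log-concavity (\<open>log_concave_young_integral\<close>). It is
  needed only for functions that decrease with \<open>\<bar>x\<bar>\<close>. Their level sets are symmetric intervals, for
  which the inequality of Brunn and Minkowski is a statement about lengths.
\<close>

section \<open>Chebyshev's association argument\<close>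

lemma ennreal_rearrangement:
  fixes u u' r s :: ennreal
  assumes "u \<le> u'" "s \<le> r"
  shows "u * r + u' * s \<le> u * s + u' * r"
proof -
  obtain d e where "u' = u + d" "r = s + e" using assms by (auto simp: le_iff_add)
  then have "u * s + u' * r = (u * r + u' * s) + d * e" by (simp add: algebra_simps)
  then show ?thesis by simp
qed

text \<open>
  Integrate the rearrangement inequality over two independent copies \<open>x\<close>, \<open>y\<close> of the variable:
  each side then splits into products of one-dimensional integrals, each counted twice.
  The hypothesis on \<open>w\<close> and \<open>m\<close> says that the ratio of \<open>w\<close> to \<open>m\<close> decreases with the modulus; in the
  product form it makes sense also where \<open>m\<close> vanishes.
\<close>

lemma chebyshev_nn_integral:
  fixes u w m :: "real \<Rightarrow> ennreal"
  assumes [measurable]: "u \<in> borel_measurable borel" "w \<in> borel_measurable borel" "m \<in> borel_measurable borel"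
    and u: "\<And>x y. \<bar>x\<bar> \<le> \<bar>y\<bar> \<Longrightarrow> u x \<le> u y"
    and wm: "\<And>x y. \<bar>x\<bar> \<le> \<bar>y\<bar> \<Longrightarrow> w y * m x \<le> w x * m y"
  shows "(\<integral>\<^sup>+x. u x * w x \<partial>lborel) * (\<integral>\<^sup>+x. m x \<partial>lborel)
       \<le> (\<integral>\<^sup>+x. u x * m x \<partial>lborel) * (\<integral>\<^sup>+x. w x \<partial>lborel)"
proof -
  have product: "(\<integral>\<^sup>+x. (\<integral>\<^sup>+y. a x * b y + a y * b x \<partial>lborel) \<partial>lborel) = 2 * ((\<integral>\<^sup>+x. a x \<partial>lborel) * (\<integral>\<^sup>+x. b x \<partial>lborel))"
    if [measurable]: "a \<in> borel_measurable borel" "b \<in> borel_measurable borel" for a b :: "real \<Rightarrow> ennreal"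
    by (simp add: nn_integral_add nn_integral_cmult nn_integral_multc mult_2 mult.commute)
  have "u x * w x * m y + u y * w y * m x \<le> u x * m x * w y + u y * m y * w x" for x y
  proof (cases "\<bar>x\<bar> \<le> \<bar>y\<bar>")
    case True
    then show ?thesis using ennreal_rearrangement[OF u[OF True] wm[OF True]] by (simp add: ac_simps)
  next
    case False
    then have yx: "\<bar>y\<bar> \<le> \<bar>x\<bar>" by simp
    show ?thesis using ennreal_rearrangement[OF u[OF yx] wm[OF yx]] by (simp add: ac_simps)
  qed
  then have "(\<integral>\<^sup>+x. (\<integral>\<^sup>+y. (u x * w x) * m y + (u y * w y) * m x \<partial>lborel) \<partial>lborel)
      \<le> (\<integral>\<^sup>+x. (\<integral>\<^sup>+y. (u x * m x) * w y + (u y * m y) * w x \<partial>lborel) \<partial>lborel)"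
    by (intro nn_integral_mono)
  then have "2 * ((\<integral>\<^sup>+x. u x * w x \<partial>lborel) * (\<integral>\<^sup>+x. m x \<partial>lborel))
      \<le> 2 * ((\<integral>\<^sup>+x. u x * m x \<partial>lborel) * (\<integral>\<^sup>+x. w x \<partial>lborel))"
    by (subst (asm) (1 2) product) auto
  then show ?thesis by (subst (asm) ennreal_mult_le_mult_iff) auto
qed

text \<open>
  Chebyshev's inequality used once in each variable. Applied to the sections of \<open>P\<close> at two points
  \<open>x\<close> and \<open>x'\<close> in the variable \<open>y\<close>, it shows that the conditional mean of \<open>v\<close> given \<open>x\<close>, which is
  \<open>w x / m x\<close> below, decreases with the modulus of \<open>x\<close>. This is the hypothesis for the second
  use, in the variable \<open>x\<close>. The hypothesis on \<open>P\<close> is reverse total positivity in the moduli.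
\<close>

lemma negative_dependence_nn_integral:
  fixes P :: "real \<Rightarrow> real \<Rightarrow> ennreal" and u v :: "real \<Rightarrow> ennreal"
  assumes P[measurable]: "case_prod P \<in> borel_measurable (borel \<Otimes>\<^sub>M borel)"
    and [measurable]: "u \<in> borel_measurable borel" "v \<in> borel_measurable borel"
    and u: "\<And>x y. \<bar>x\<bar> \<le> \<bar>y\<bar> \<Longrightarrow> u x \<le> u y"
    and v: "\<And>x y. \<bar>x\<bar> \<le> \<bar>y\<bar> \<Longrightarrow> v x \<le> v y"
    and PP: "\<And>x x' y y'. \<bar>x\<bar> \<le> \<bar>x'\<bar> \<Longrightarrow> \<bar>y\<bar> \<le> \<bar>y'\<bar> \<Longrightarrow> P x y * P x' y' \<le> P x y' * P x' y"
  shows "(\<integral>\<^sup>+x. \<integral>\<^sup>+y. u x * v y * P x y \<partial>lborel \<partial>lborel) * (\<integral>\<^sup>+x. \<integral>\<^sup>+y. P x y \<partial>lborel \<partial>lborel)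
       \<le> (\<integral>\<^sup>+x. \<integral>\<^sup>+y. u x * P x y \<partial>lborel \<partial>lborel) * (\<integral>\<^sup>+x. \<integral>\<^sup>+y. v y * P x y \<partial>lborel \<partial>lborel)"
proof -
  define w where "w x = (\<integral>\<^sup>+y. v y * P x y \<partial>lborel)" for x
  define m where "m x = (\<integral>\<^sup>+y. P x y \<partial>lborel)" for x
  have [measurable]: "w \<in> borel_measurable borel" "m \<in> borel_measurable borel"
    unfolding w_def m_def by measurable
  have "w x' * m x \<le> w x * m x'" if xx: "\<bar>x\<bar> \<le> \<bar>x'\<bar>" for x x'
  proof -
    have "w x' * m x \<le> m x' * w x" unfolding w_def m_def mult.commute[of "integral\<^sup>N lborel (P x')"]
      using chebyshev_nn_integral[of v "P x'" "P x"] v PP[OF xx] 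
      by (auto simp: mult.commute)
    then show ?thesis by (simp add: mult.commute)
  qed
  from chebyshev_nn_integral[of u w m, OF _ _ _ u this] show ?thesis
    by (simp add: w_def m_def nn_integral_cmult mult.assoc)
qed

section \<open>A one-dimensional Prekopa-Leindler inequality\<close>

definition radially_decreasing :: "(real \<Rightarrow> real) \<Rightarrow> bool" where
  "radially_decreasing F \<longleftrightarrow> (\<forall>x y. \<bar>x\<bar> \<le> \<bar>y\<bar> \<longrightarrow> F y \<le> F x)"

lemma borel_measurable_abs_mono_on:
  fixes u :: "real \<Rightarrow> real"
  assumes "mono_on {0..} u"
  shows "(\<lambda>x. u \<bar>x\<bar>) \<in> borel_measurable borel"
proof -
  have "mono (\<lambda>x. u (max 0 x))" using assms by (auto simp: mono_def mono_on_def)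
  then have [measurable]: "(\<lambda>x. u (max 0 x)) \<in> borel_measurable borel" by (rule borel_measurable_mono)
  have "(\<lambda>x. u (max 0 \<bar>x\<bar>)) \<in> borel_measurable borel" by measurable
  then show ?thesis by simp
qed

lemma radially_decreasing_measurable:
  assumes "radially_decreasing F" shows "F \<in> borel_measurable borel"
proof -
  have "mono_on {0..} (\<lambda>x. - F x)" using assms by (auto simp: mono_on_def radially_decreasing_def)
  from borel_measurable_abs_mono_on[OF this] have "(\<lambda>x. - F \<bar>x\<bar>) \<in> borel_measurable borel" .
  moreover have "F \<bar>x\<bar> = F x" for x using assms by (auto simp: radially_decreasing_def intro: antisym)
  ultimately show ?thesis by (simp add: borel_measurable_uminus_eq)
qed

lemma nn_integral_layer_cake:
  fixes u :: "real \<Rightarrow> real"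
  assumes [measurable]: "u \<in> borel_measurable borel" and nn: "\<And>x. 0 \<le> u x"
  shows "(\<integral>\<^sup>+x. u x \<partial>lborel) = (\<integral>\<^sup>+s. emeasure lborel {x. s < u x} * indicator {0<..} s \<partial>lborel)"
proof -
  let ?k = "\<lambda>x s. indicator {s. 0 < s \<and> s < u x} s :: ennreal"
  have "ennreal (u x) = (\<integral>\<^sup>+s. ?k x s \<partial>lborel)" for x
  proof -
    have "{s. 0 < s \<and> s < u x} = {0<..<u x}" by auto
    then show ?thesis using nn[of x] by simp
  qed
  then have "(\<integral>\<^sup>+x. u x \<partial>lborel) = (\<integral>\<^sup>+x. \<integral>\<^sup>+s. ?k x s \<partial>lborel \<partial>lborel)" by simp
  also have "\<dots> = (\<integral>\<^sup>+s. \<integral>\<^sup>+x. ?k x s \<partial>lborel \<partial>lborel)"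
    by (rule lborel_pair.Fubini'[symmetric]) (simp add: indicator_def)
  also have "\<dots> = (\<integral>\<^sup>+s. emeasure lborel {x. s < u x} * indicator {0<..} s \<partial>lborel)"
  proof (intro nn_integral_cong)
    fix s :: real
    have "(\<integral>\<^sup>+x. ?k x s \<partial>lborel) = (\<integral>\<^sup>+x. indicator {x. s < u x} x * indicator {0<..} s \<partial>lborel)"
      by (intro nn_integral_cong) (auto simp: indicator_def)
    then show "(\<integral>\<^sup>+x. ?k x s \<partial>lborel) = emeasure lborel {x. s < u x} * indicator {0<..} s"
      by (simp add: nn_integral_multc)
  qed
  finally show ?thesis .
qed

text \<open>
  The hypothesis makes \<open>C\<close> contain the open interval whose half-length is the weighted mean of the
  radii of \<open>A\<close> and \<open>B\<close>, where the radius is the supremum of the moduli.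
\<close>

lemma brunn_minkowski_symmetric_intervals:
  fixes A B C :: "real set"
  assumes t: "0 < t" "t < 1"
    and A: "A \<subseteq> {-R..R}" "A \<noteq> {}" and B: "B \<subseteq> {-R..R}" "B \<noteq> {}"
    and C: "C \<in> sets borel"
    and ABC: "\<And>x y z. x \<in> A \<Longrightarrow> y \<in> B \<Longrightarrow> \<bar>z\<bar> \<le> (1 - t) * \<bar>x\<bar> + t * \<bar>y\<bar> \<Longrightarrow> z \<in> C"
  shows "ennreal (1 - t) * emeasure lborel A + ennreal t * emeasure lborel B \<le> emeasure lborel C"
proof -
  define \<alpha> where "\<alpha> = Sup (abs ` A)"
  define \<beta> where "\<beta> = Sup (abs ` B)"
  have bdd: "bdd_above (abs ` A)" "bdd_above (abs ` B)"
    using A(1) B(1) by (auto intro!: bdd_aboveI[of _ R] simp: abs_le_iff subset_iff minus_le_iff)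
  have \<alpha>: "\<bar>x\<bar> \<le> \<alpha>" if "x \<in> A" for x unfolding \<alpha>_def using that bdd by (auto intro: cSup_upper)
  have \<beta>: "\<bar>x\<bar> \<le> \<beta>" if "x \<in> B" for x unfolding \<beta>_def using that bdd by (auto intro: cSup_upper)
  have nn: "0 \<le> \<alpha>" "0 \<le> \<beta>" using A(2) B(2) \<alpha> \<beta> by (meson abs_ge_zero all_not_in_conv order_trans)+
  have eA: "emeasure lborel A \<le> ennreal (2 * \<alpha>)"
  proof -
    have "emeasure lborel A \<le> emeasure lborel {-\<alpha>..\<alpha>}"
      using \<alpha> by (intro emeasure_mono) (auto simp: abs_le_iff, smt (verit))
    then show ?thesis using nn by simp
  qed
  have eB: "emeasure lborel B \<le> ennreal (2 * \<beta>)"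
  proof -
    have "emeasure lborel B \<le> emeasure lborel {-\<beta>..\<beta>}"
      using \<beta> by (intro emeasure_mono) (auto simp: abs_le_iff, smt (verit))
    then show ?thesis using nn by simp
  qed
  define \<gamma> where "\<gamma> = (1 - t) * \<alpha> + t * \<beta>"
  have \<gamma>: "0 \<le> \<gamma>" using nn t by (simp add: \<gamma>_def)
  have "{-\<gamma><..<\<gamma>} \<subseteq> C"
  proof
    fix z assume "z \<in> {-\<gamma><..<\<gamma>}"
    then have z: "\<bar>z\<bar> < \<gamma>" by auto
    define e where "e = \<gamma> - \<bar>z\<bar>"
    have "e > 0" using z by (simp add: e_def)
    (* A point strictly inside leaves a margin e, by which both suprema may be missed. *)
    obtain x where x: "x \<in> A" "\<alpha> - e < \<bar>x\<bar>"
      using less_cSupD[of "abs ` A" "\<alpha> - e"] A(2) \<open>e > 0\<close> by (auto simp: \<alpha>_def[symmetric])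
    obtain y where y: "y \<in> B" "\<beta> - e < \<bar>y\<bar>"
      using less_cSupD[of "abs ` B" "\<beta> - e"] B(2) \<open>e > 0\<close> by (auto simp: \<beta>_def[symmetric])
    have "(1 - t) * (\<alpha> - e) \<le> (1 - t) * \<bar>x\<bar>" "t * (\<beta> - e) \<le> t * \<bar>y\<bar>"
      using x y t by (auto intro!: mult_left_mono)
    then have "\<bar>z\<bar> \<le> (1 - t) * \<bar>x\<bar> + t * \<bar>y\<bar>"
      by (simp add: e_def \<gamma>_def algebra_simps)
    then show "z \<in> C" using ABC x y by blast
  qed
  then have "ennreal (2 * \<gamma>) \<le> emeasure lborel C"
    using emeasure_mono[of "{-\<gamma><..<\<gamma>}" C lborel] C \<gamma> by simp
  moreover have "ennreal (1 - t) * emeasure lborel A + ennreal t * emeasure lborel B \<le> ennreal (1-t) * ennreal (2 * \<alpha>) + ennreal t * ennreal (2 * \<beta>)"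
    by (intro add_mono mult_left_mono eA eB) auto
  moreover have "\<dots> = ennreal (2 * \<gamma>)"
  proof -
    have "ennreal (1-t) * ennreal (2 * \<alpha>) + ennreal t * ennreal (2 * \<beta>) = ennreal ((1 - t) * (2 * \<alpha>)) + ennreal (t * (2 * \<beta>))"
      using nn t by (simp add: ennreal_mult)
    also have "\<dots> = ennreal ((1 - t) * (2 * \<alpha>) + t * (2 * \<beta>))"
      using nn t by (intro ennreal_plus[symmetric]) auto
    finally show ?thesis by (simp add: \<gamma>_def algebra_simps)
  qed
  ultimately show ?thesis by simp
qed

text \<open>
  By the layer-cake formula it suffices to compare, for each level, the sets where the three
  functions exceed it, and this is the Brunn-Minkowski inequality for symmetric intervals. That
  inequality needs both sets to be nonempty. This is why \<open>F\<close> and \<open>G\<close> are normalized to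
  have the same maximum: their level sets are then nonempty for exactly the same levels.
\<close>

lemma prekopa_leindler_normalized:
  fixes F G H :: "real \<Rightarrow> real"
  assumes t: "0 < t" "t < 1"
    and rad: "radially_decreasing F" "radially_decreasing G" "radially_decreasing H"
    and nonneg: "\<And>x. 0 \<le> F x" "\<And>x. 0 \<le> G x" "\<And>x. 0 \<le> H x"
    and supp: "\<And>x. \<bar>x\<bar> > R \<Longrightarrow> F x = 0" "\<And>x. \<bar>x\<bar> > R \<Longrightarrow> G x = 0"
    and one: "F 0 = 1" "G 0 = 1"
    and level: "\<And>s x y. 0 < s \<Longrightarrow> 0 \<le> x \<Longrightarrow> 0 \<le> y \<Longrightarrow> s < F x \<Longrightarrow> s < G y \<Longrightarrow> s < H ((1 - t) * x + t * y)"
  shows "ennreal (1 - t) * (\<integral>\<^sup>+x. F x \<partial>lborel) + ennreal t * (\<integral>\<^sup>+x. G x \<partial>lborel) \<le> (\<integral>\<^sup>+x. H x \<partial>lborel)"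
proof -
  have [measurable]: "F \<in> borel_measurable borel" "G \<in> borel_measurable borel" "H \<in> borel_measurable borel"
    using rad by (auto intro: radially_decreasing_measurable)
  have even: "F \<bar>x\<bar> = F x" "G \<bar>x\<bar> = G x" for x
    using rad by (auto simp: radially_decreasing_def intro!: antisym)
  let ?e = "\<lambda>F s. emeasure lborel {x. s < F x} * indicator {0<..} (s::real)"
  have le1: "F x \<le> 1" "G x \<le> 1" for x
    using rad one unfolding radially_decreasing_def by (metis abs_ge_zero abs_zero)+
  have "ennreal (1 - t) * ?e F s + ennreal t * ?e G s \<le> ?e H s" for s
  proof (cases "0 < s \<and> s < 1")
    case True
    have "ennreal (1 - t) * emeasure lborel {x. s < F x} + ennreal t * emeasure lborel {x. s < G x} \<le> emeasure lborel {x. s < H x}"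
    proof (rule brunn_minkowski_symmetric_intervals[OF t])
      show "{x. s < F x} \<subseteq> {-R..R}" "{x. s < G x} \<subseteq> {-R..R}" using supp True by (auto, (smt (verit))+)
      show "{x. s < F x} \<noteq> {}" "{x. s < G x} \<noteq> {}" using one True by (auto intro!: exI[of _ 0])
      fix x y z assume *: "x \<in> {x. s < F x}" "y \<in> {x. s < G x}" "\<bar>z\<bar> \<le> (1 - t) * \<bar>x\<bar> + t * \<bar>y\<bar>"
      then have "s < H ((1 - t) * \<bar>x\<bar> + t * \<bar>y\<bar>)" using True by (intro level) (auto simp: even)
      also have "\<dots> \<le> H z" using rad(3) *(3) by (auto simp: radially_decreasing_def)
      finally show "z \<in> {x. s < H x}" by simp
    qed simp
    then show ?thesis using True by simp
  next
    case False
    then consider "s \<le> 0" | "1 \<le> s" by linarith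
    then show ?thesis
    proof cases
      case 2
      then have "{x. s < F x} = {}" "{x. s < G x} = {}" using le1 by (auto simp: not_less intro: order_trans)
      then show ?thesis by simp
    qed simp
  qed
  then have "(\<integral>\<^sup>+s. ennreal (1 - t) * ?e F s + ennreal t * ?e G s \<partial>lborel) \<le> (\<integral>\<^sup>+s. ?e H s \<partial>lborel)"
    by (intro nn_integral_mono)
  moreover have [measurable]: "(\<lambda>s. emeasure lborel {x. s < U x}) \<in> borel_measurable borel"
    if [measurable]: "U \<in> borel_measurable borel" for U :: "real \<Rightarrow> real"
  proof -
    have "(\<lambda>s. emeasure lborel {x \<in> space lborel. (s, x) \<in> {p. fst p < U (snd p)}}) \<in> borel_measurable borel"
      by measurable
    then show ?thesis by simp
  qed
  ultimately show ?thesis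
    by (simp add: nn_integral_layer_cake nonneg nn_integral_add nn_integral_cmult)
qed

text \<open>
  Dividing \<open>F\<close> and \<open>G\<close> by their maxima, which they attain at 0, and \<open>H\<close> by the corresponding geometric
  mean \<open>c\<close> reduces the claim to the normalized case. This yields the arithmetic mean of the scaled
  integrals, and Young's inequality replaces it by the smaller geometric mean.
\<close>

lemma prekopa_leindler_radial:
  fixes F G H :: "real \<Rightarrow> real"
  assumes t: "0 < t" "t < 1"
    and rad: "radially_decreasing F" "radially_decreasing G" "radially_decreasing H"
    and nonneg: "\<And>x. 0 \<le> F x" "\<And>x. 0 \<le> G x" "\<And>x. 0 \<le> H x"
    and supp: "\<And>x. \<bar>x\<bar> > R \<Longrightarrow> F x = 0" "\<And>x. \<bar>x\<bar> > R \<Longrightarrow> G x = 0"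
    and FGH: "\<And>x y. 0 \<le> x \<Longrightarrow> 0 \<le> y \<Longrightarrow> F x powr (1 - t) * G y powr t \<le> H ((1 - t) * x + t * y)"
    and int: "(\<integral>\<^sup>+x. F x \<partial>lborel) = ennreal A" "(\<integral>\<^sup>+x. G x \<partial>lborel) = ennreal B" "(\<integral>\<^sup>+x. H x \<partial>lborel) = ennreal C"
    and ABC: "0 \<le> A" "0 \<le> B" "0 \<le> C"
  shows "A powr (1 - t) * B powr t \<le> C"
proof (cases "0 < A \<and> 0 < B")
  case False
  then show ?thesis using ABC by auto
next
  case True
  have F0: "F 0 > 0"
  proof (rule ccontr)
    assume "\<not> F 0 > 0"
    moreover have "F x \<le> F 0" for x using rad(1) by (simp add: radially_decreasing_def)
    ultimately have "F x = 0" for x using nonneg(1)[of x] by (meson not_less order.trans antisym)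
    then show False using int(1) True by simp
  qed
  have G0: "G 0 > 0"
  proof (rule ccontr)
    assume "\<not> G 0 > 0"
    moreover have "G x \<le> G 0" for x using rad(2) by (simp add: radially_decreasing_def)
    ultimately have "G x = 0" for x using nonneg(2)[of x] by (meson not_less order.trans antisym)
    then show False using int(2) True by simp
  qed
  define c where "c = F 0 powr (1 - t) * G 0 powr t"
  have c: "c > 0" using F0 G0 by (simp add: c_def)
  have scale: "(\<integral>\<^sup>+x. ennreal (U x / d) \<partial>lborel) = ennreal (E / d)"
    if "radially_decreasing U" "\<And>x. 0 \<le> U x" "d > 0" "(\<integral>\<^sup>+x. U x \<partial>lborel) = ennreal E" "0 \<le> E" for U d E
  proof -
    have [measurable]: "U \<in> borel_measurable borel" using that(1) by (rule radially_decreasing_measurable)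
    have "(\<integral>\<^sup>+x. ennreal (U x / d) \<partial>lborel) = (\<integral>\<^sup>+x. ennreal (U x) / ennreal d \<partial>lborel)"
      using that(2,3) by (auto intro!: nn_integral_cong simp: divide_ennreal)
    also have "\<dots> = ennreal (E / d)" using that(3,4,5) by (simp add: nn_integral_divide divide_ennreal)
    finally show ?thesis .
  qed
  have "ennreal (1 - t) * (\<integral>\<^sup>+x. ennreal (F x / F 0) \<partial>lborel) + ennreal t * (\<integral>\<^sup>+x. ennreal (G x / G 0) \<partial>lborel)
      \<le> (\<integral>\<^sup>+x. ennreal (H x / c) \<partial>lborel)"
  proof (rule prekopa_leindler_normalized[OF t])
    show "radially_decreasing (\<lambda>x. F x / F 0)" "radially_decreasing (\<lambda>x. G x / G 0)" "radially_decreasing (\<lambda>x. H x / c)"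
      using rad F0 G0 c by (auto simp: radially_decreasing_def divide_right_mono)
    (* The geometric mean with weights adding up to 1 exceeds any level that both factors exceed. *)
    fix s x y :: real
    assume s: "0 < s" and xy: "0 \<le> x" "0 \<le> y" and sF: "s < F x / F 0" and sG: "s < G y / G 0"
    have "s = s powr (1 - t) * s powr t" using s by (simp add: powr_add[symmetric])
    also have "\<dots> < (F x / F 0) powr (1 - t) * (G y / G 0) powr t"
      using s t sF sG by (intro mult_strict_mono powr_less_mono2) auto
    also have "\<dots> = (F x powr (1 - t) * G y powr t) / c"
      using F0 G0 nonneg by (simp add: powr_divide c_def)
    also have "\<dots> \<le> H ((1 - t) * x + t * y) / c"
      using FGH[OF xy] c by (intro divide_right_mono) auto
    finally show "s < H ((1 - t) * x + t * y) / c" .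
  qed (use nonneg supp F0 G0 c in auto)
  then have "ennreal (1 - t) * ennreal (A / F 0) + ennreal t * ennreal (B / G 0) \<le> ennreal (C / c)"
    using scale[OF rad(1) nonneg(1) F0 int(1) ABC(1)] scale[OF rad(2) nonneg(2) G0 int(2) ABC(2)]
      scale[OF rad(3) nonneg(3) c int(3) ABC(3)] by simp
  then have AB: "(1 - t) * (A / F 0) + t * (B / G 0) \<le> C / c"
    using t F0 G0 c ABC
    by (subst (asm) (1 2) ennreal_mult[symmetric]) (auto simp: ennreal_plus[symmetric] simp del: ennreal_plus)
  have "(A powr (1 - t) * B powr t) / c = (A / F 0) powr (1 - t) * (B / G 0) powr t"
    using F0 G0 ABC by (simp add: powr_divide c_def)
  also have "\<dots> \<le> (1 - t) * (A / F 0) + t * (B / G 0)"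
    using t True F0 G0 by (intro Youngs_inequality_0) auto
  also note AB
  finally show ?thesis using c by (simp add: divide_le_cancel)
qed

section \<open>Log-concavity of the volumes of sublevel sets\<close>

definition log_concave :: "(real \<Rightarrow> real) \<Rightarrow> bool" where
  "log_concave V \<longleftrightarrow> (\<forall>s. 0 \<le> V s) \<and>
     (\<forall>a b t. 0 < t \<longrightarrow> t < 1 \<longrightarrow> V a powr (1 - t) * V b powr t \<le> V ((1 - t) * a + t * b))"

text \<open>
  The inner points \<open>b\<close> and \<open>c\<close> are the convex combinations of \<open>a\<close> and \<open>d\<close> with weights
  \<open>t\<close> and \<open>1 - t\<close> interchanged, so multiplying the two instances of log-concavity restores the full
  powers of the values at \<open>a\<close> and \<open>d\<close>.
\<close>

lemma log_concave_four_points: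
  assumes V: "log_concave V" and ab: "a \<le> b" "b \<le> d" and sum: "a + d = b + c"
  shows "V a * V d \<le> V b * V c"
proof (cases "a < b \<and> b < d")
  case False
  then have "(b = a \<and> c = d) \<or> (b = d \<and> c = a)" using ab sum by auto
  then show ?thesis by auto
next
  case True
  define t where "t = (b - a) / (d - a)"
  have t: "0 < t" "t < 1" using True by (auto simp: t_def)
  have "t * (d - a) = b - a" using True by (simp add: t_def)
  then have b: "b = (1 - t) * a + t * d" and c: "c = (1 - (1 - t)) * a + (1 - t) * d"
    using sum by (simp_all add: algebra_simps)
  have nn: "0 \<le> V s" for s using V by (simp add: log_concave_def)
  have "V a * V d = (V a powr (1 - t) * V a powr t) * (V d powr (1 - t) * V d powr t)"
    using nn by (simp add: powr_add[symmetric])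
  also have "\<dots> = (V a powr (1 - t) * V d powr t) * (V a powr (1 - (1 - t)) * V d powr (1 - t))"
    by simp
  also have "\<dots> \<le> V b * V c"
  proof (rule mult_mono)
    show "V a powr (1 - t) * V d powr t \<le> V b" unfolding b using V t unfolding log_concave_def by blast
    have "0 < 1 - t" "1 - t < 1" using t by auto
    then show "V a powr (1 - (1 - t)) * V d powr (1 - t) \<le> V c" unfolding c using V unfolding log_concave_def by blast
  qed (use nn in auto)
  finally show ?thesis .
qed

lemma young_function_nonneg: "young_function \<phi> \<Longrightarrow> 0 \<le> x \<Longrightarrow> 0 \<le> \<phi> x"
  by (simp add: young_function_def)

lemma young_function_mono: "young_function \<phi> \<Longrightarrow> 0 \<le> x \<Longrightarrow> x \<le> y \<Longrightarrow> \<phi> x \<le> \<phi> y"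
  unfolding young_function_def strict_mono_on_def by (cases "x = y") (auto intro: less_imp_le)

lemma young_function_convex:
  "young_function \<phi> \<Longrightarrow> 0 \<le> x \<Longrightarrow> 0 \<le> y \<Longrightarrow> 0 \<le> t \<Longrightarrow> t \<le> 1 \<Longrightarrow>
    \<phi> ((1 - t) * x + t * y) \<le> (1 - t) * \<phi> x + t * \<phi> y"
  unfolding young_function_def using convex_onD[of "{0..}" \<phi> t x y] by simp

text \<open>
  Convexity on the segment from 0 to \<open>x\<close> gives the linear lower bound \<open>x * \<phi> 1 \<le> \<phi> x\<close>
  for \<open>x \<ge> 1\<close>, and \<open>\<phi> 1\<close> is positive by strict monotonicity.
\<close>

lemma young_function_unbounded:
  assumes \<phi>: "young_function \<phi>"
  obtains R where "0 \<le> R" "\<And>x. R < x \<Longrightarrow> s < \<phi> x"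
proof
  have \<phi>1: "\<phi> 1 > 0" using \<phi> unfolding young_function_def strict_mono_on_def by (metis atLeast_iff order_refl zero_le_one zero_less_one)
  show "0 \<le> max 1 (s / \<phi> 1)" by simp
  fix x assume x: "max 1 (s / \<phi> 1) < x"
  then have "s < x * \<phi> 1" using \<phi>1 by (simp add: divide_less_eq)
  also have "\<phi> ((1 - 1 / x) * 0 + (1 / x) * x) \<le> (1 - 1 / x) * \<phi> 0 + (1 / x) * \<phi> x"
    using x by (intro young_function_convex[OF \<phi>]) auto
  then have "x * \<phi> 1 \<le> \<phi> x" using x \<phi> by (simp add: young_function_def field_simps)
  finally show "s < \<phi> x" .
qed

lemma young_function_measurable: "young_function \<phi> \<Longrightarrow> (\<lambda>x. \<phi> \<bar>x\<bar>) \<in> borel_measurable borel"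
  by (rule borel_measurable_abs_mono_on) (auto simp: mono_on_def young_function_mono)

text \<open>
  Since \<open>V\<close> is increasing and \<open>\<phi>\<close> is convex, the integrand is log-concave jointly in \<open>s\<close> and
  \<open>\<bar>x\<bar>\<close>; it is radially decreasing in \<open>x\<close>. The Prekopa-Leindler inequality integrates \<open>x\<close> out.
  The vanishing of \<open>V\<close> on negative arguments gives the integrands bounded supports.
\<close>

lemma log_concave_young_integral:
  fixes V W :: "real \<Rightarrow> real"
  assumes \<phi>: "young_function \<phi>" and V: "log_concave V" "mono V" and V0: "\<And>s. s < 0 \<Longrightarrow> V s = 0"
    and W: "\<And>s. 0 \<le> W s" "\<And>s. (\<integral>\<^sup>+x. V (s - \<phi> \<bar>x\<bar>) \<partial>lborel) = ennreal (W s)"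
  shows "log_concave W"
  unfolding log_concave_def
proof (intro conjI allI impI W(1))
  fix a b t :: real assume t: "0 < t" "t < 1"
  obtain R where R: "\<And>x. R < x \<Longrightarrow> max a b < \<phi> x"
    using young_function_unbounded[OF \<phi>] by metis
  have nn: "0 \<le> V s" for s using V by (simp add: log_concave_def)
  have rad: "radially_decreasing (\<lambda>x. V (s - \<phi> \<bar>x\<bar>))" for s
    unfolding radially_decreasing_def
    by (auto intro!: monoD[OF V(2)] simp: young_function_mono[OF \<phi>])
  show "W a powr (1 - t) * W b powr t \<le> W ((1 - t) * a + t * b)"
  proof (rule prekopa_leindler_radial[OF t rad[of a] rad[of b] rad[of "(1 - t) * a + t * b"] nn nn nn, where R = R])
    show "V (a - \<phi> \<bar>x\<bar>) = 0" "V (b - \<phi> \<bar>x\<bar>) = 0" if "R < \<bar>x\<bar>" for x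
      using R[OF that] by (auto intro!: V0)
    fix x y :: real assume xy: "0 \<le> x" "0 \<le> y"
    have "V (a - \<phi> x) powr (1 - t) * V (b - \<phi> y) powr t \<le> V ((1 - t) * (a - \<phi> x) + t * (b - \<phi> y))"
      using V t by (simp add: log_concave_def)
    also have "\<dots> \<le> V ((1 - t) * a + t * b - \<phi> ((1 - t) * x + t * y))"
      using young_function_convex[OF \<phi> xy, of t] t by (intro monoD[OF V(2)]) (simp add: algebra_simps)
    finally show "V (a - \<phi> \<bar>x\<bar>) powr (1 - t) * V (b - \<phi> \<bar>y\<bar>) powr t
        \<le> V ((1 - t) * a + t * b - \<phi> \<bar>(1 - t) * x + t * y\<bar>)"
      using xy t by simp
  qed (use W in auto)
qed

text \<open>
  The index set is a parameter, so that coordinates can be removed one at a time. The value is an extended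
  real because the volumes arise as iterated nonnegative integrals; they are finite for Young functions.
\<close>

definition sublevel_volume :: "('k \<Rightarrow> real \<Rightarrow> real) \<Rightarrow> 'k set \<Rightarrow> real \<Rightarrow> ennreal" where
  "sublevel_volume \<phi> I s =
     (\<integral>\<^sup>+z. indicator {z. (\<Sum>k\<in>I. \<phi> k \<bar>z k\<bar>) \<le> s} z \<partial>PiM I (\<lambda>_. lborel))"

lemma product_sigma_finite_lborel: "product_sigma_finite (\<lambda>_. lborel :: real measure)"
  by unfold_locales

lemma indicator_sublevel_fun_upd:
  fixes \<phi> :: "'k \<Rightarrow> real \<Rightarrow> real"
  assumes "finite I" "i \<notin> I"
  shows "indicator {z. (\<Sum>k\<in>insert i I. \<phi> k \<bar>z k\<bar>) \<le> s} (z(i := x))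
       = (indicator {z. (\<Sum>k\<in>I. \<phi> k \<bar>z k\<bar>) \<le> s - \<phi> i \<bar>x\<bar>} z :: ennreal)"
proof -
  have "(\<Sum>k\<in>I. \<phi> k \<bar>(z(i := x)) k\<bar>) = (\<Sum>k\<in>I. \<phi> k \<bar>z k\<bar>)"
    using assms(2) by (intro sum.cong) auto
  then show ?thesis using assms by (simp add: indicator_def algebra_simps)
qed

lemma sublevel_indicator_measurable:
  assumes "\<And>k. k \<in> I \<Longrightarrow> young_function (\<phi> k)"
  shows "(\<lambda>z. indicator {z. (\<Sum>k\<in>I. \<phi> k \<bar>z k\<bar>) \<le> s} z :: ennreal) \<in> borel_measurable (PiM I (\<lambda>_. lborel))"
proof -
  have [measurable]: "(\<lambda>z. \<phi> k \<bar>z k\<bar>) \<in> borel_measurable (PiM I (\<lambda>_. lborel))" if "k \<in> I" for k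
    using that young_function_measurable[OF assms[OF that]]
    by (intro measurable_compose[of "\<lambda>z. z k" _ borel "\<lambda>x. \<phi> k \<bar>x\<bar>"]) auto
  have "(\<lambda>z. indicator {z. z \<le> s} (\<Sum>k\<in>I. \<phi> k \<bar>z k\<bar>) :: ennreal) \<in> borel_measurable (PiM I (\<lambda>_. lborel))"
    by measurable
  then show ?thesis by (simp add: indicator_def)
qed

lemma sublevel_volume_insert:
  assumes I: "finite I" "i \<notin> I" and \<phi>: "\<And>k. k \<in> insert i I \<Longrightarrow> young_function (\<phi> k)"
  shows "sublevel_volume \<phi> (insert i I) s = (\<integral>\<^sup>+x. sublevel_volume \<phi> I (s - \<phi> i \<bar>x\<bar>) \<partial>lborel)"
proof -
  interpret product_sigma_finite "\<lambda>_. lborel :: real measure" by (rule product_sigma_finite_lborel)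
  show ?thesis unfolding sublevel_volume_def
    by (subst product_nn_integral_insert_rev[OF I sublevel_indicator_measurable[OF \<phi>]])
       (auto intro!: nn_integral_cong indicator_sublevel_fun_upd[OF I])
qed

lemma sublevel_volume_mono: "a \<le> b \<Longrightarrow> sublevel_volume \<phi> I a \<le> sublevel_volume \<phi> I b"
  unfolding sublevel_volume_def by (intro nn_integral_mono) (auto simp: indicator_def)

lemma sublevel_volume_negative:
  assumes "\<And>k. k \<in> I \<Longrightarrow> young_function (\<phi> k)" "s < 0"
  shows "sublevel_volume \<phi> I s = 0"
proof -
  have "0 \<le> (\<Sum>k\<in>I. \<phi> k \<bar>z k\<bar>)" for z
    using assms(1) by (simp add: sum_nonneg young_function_nonneg)
  then have "\<not> (\<Sum>k\<in>I. \<phi> k \<bar>z k\<bar>) \<le> s" for z using assms(2)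
    by (auto simp: not_le intro: order.strict_trans2)
  then show ?thesis by (simp add: sublevel_volume_def)
qed

lemma sublevel_volume_finite:
  assumes "finite I" "\<And>k. k \<in> I \<Longrightarrow> young_function (\<phi> k)"
  shows "sublevel_volume \<phi> I s < \<infinity>"
  using assms
proof (induction I arbitrary: s rule: finite_induct)
  case empty
  show ?case by (simp add: sublevel_volume_def PiM_empty)
next
  case (insert i I)
  obtain R where R: "\<And>x. R < x \<Longrightarrow> s < \<phi> i x" "0 \<le> R"
    using young_function_unbounded[OF insert.prems[of i]] by (metis insertI1)
  have "sublevel_volume \<phi> (insert i I) s = (\<integral>\<^sup>+x. sublevel_volume \<phi> I (s - \<phi> i \<bar>x\<bar>) \<partial>lborel)"
    using insert by (intro sublevel_volume_insert) auto
  also have "\<dots> \<le> (\<integral>\<^sup>+x. sublevel_volume \<phi> I s * indicator {-R..R} x \<partial>lborel)"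
  proof (intro nn_integral_mono)
    fix x :: real
    show "sublevel_volume \<phi> I (s - \<phi> i \<bar>x\<bar>) \<le> sublevel_volume \<phi> I s * indicator {-R..R} x"
    proof (cases "\<bar>x\<bar> \<le> R")
      case True
      then show ?thesis using young_function_nonneg[OF insert.prems[of i], of "\<bar>x\<bar>"]
        by (auto intro!: sublevel_volume_mono simp: abs_le_iff)
    next
      case False
      then show ?thesis using R(1)[of "\<bar>x\<bar>"] insert.prems by (subst sublevel_volume_negative) auto
    qed
  qed
  also have "\<dots> = sublevel_volume \<phi> I s * ennreal (2 * R)" using R(2) by (simp add: nn_integral_cmult)
  also have "\<dots> < \<infinity>" using insert by (simp add: ennreal_mult_less_top)
  finally show ?case .
qed

text \<open>
  Induction over the coordinates, each of which is integrated out by \<open>log_concave_young_integral\<close>.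
  For the empty index set the volume is the indicator function of the half-line \<open>{0..}\<close>, because
  the product over no coordinates is a point.
\<close>

lemma sublevel_volume_log_concave:
  assumes "finite I" "\<And>k. k \<in> I \<Longrightarrow> young_function (\<phi> k)"
  shows "log_concave (\<lambda>s. enn2real (sublevel_volume \<phi> I s))"
  using assms
proof (induction I rule: finite_induct)
  case empty
  have "sublevel_volume \<phi> {} s = indicator {0..} s" for s
    by (simp add: sublevel_volume_def PiM_empty nn_integral_count_space_finite indicator_def)
  then have "enn2real (sublevel_volume \<phi> {} s) = (if 0 \<le> s then 1 else 0)" for s
    by (simp add: indicator_def)
  moreover have "0 \<le> (1 - t) * a + t * b" if "0 < t" "t < 1" "0 \<le> a" "0 \<le> b" for a b t :: real
    using that by simp
  ultimately show ?case by (simp add: log_concave_def)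
next
  case (insert i I)
  have young: "young_function (\<phi> k)" if "k \<in> I" for k using insert.prems that by simp
  have fin: "sublevel_volume \<phi> I s < \<infinity>" for s using insert.hyps young by (intro sublevel_volume_finite) auto
  have fin': "sublevel_volume \<phi> (insert i I) s < \<infinity>" for s using insert by (intro sublevel_volume_finite) auto
  show ?case
  proof (rule log_concave_young_integral)
    show "young_function (\<phi> i)" using insert.prems by simp
    show "log_concave (\<lambda>s. enn2real (sublevel_volume \<phi> I s))" using insert.IH young by blast
    show "mono (\<lambda>s. enn2real (sublevel_volume \<phi> I s))"
      using fin by (auto intro!: monoI enn2real_mono sublevel_volume_mono simp: less_top)
    show "enn2real (sublevel_volume \<phi> I s) = 0" if "s < 0" for s
      using that young by (simp add: sublevel_volume_negative)
    show "(\<integral>\<^sup>+x. enn2real (sublevel_volume \<phi> I (s - \<phi> i \<bar>x\<bar>)) \<partial>lborel)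
        = ennreal (enn2real (sublevel_volume \<phi> (insert i I) s))" for s
      using fin fin' sublevel_volume_insert[of I i \<phi> s, OF insert.hyps(1,2) insert.prems, symmetric]
      by (simp add: less_top)
  qed simp
qed

lemma sublevel_volume_measurable:
  assumes "finite I" "\<And>k. k \<in> I \<Longrightarrow> young_function (\<phi> k)"
  shows "sublevel_volume \<phi> I \<in> borel_measurable borel"
proof -
  have fin: "sublevel_volume \<phi> I s \<noteq> \<top>" for s
    using sublevel_volume_finite[of I \<phi> s, OF assms] by (simp add: less_top)
  have "mono (\<lambda>s. enn2real (sublevel_volume \<phi> I s))"
    using fin by (auto intro!: monoI enn2real_mono sublevel_volume_mono simp: less_top)
  then have [measurable]: "(\<lambda>s. enn2real (sublevel_volume \<phi> I s)) \<in> borel_measurable borel"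
    by (rule borel_measurable_mono)
  have "(\<lambda>s. ennreal (enn2real (sublevel_volume \<phi> I s))) \<in> borel_measurable borel" by measurable
  moreover have "(\<lambda>s. ennreal (enn2real (sublevel_volume \<phi> I s))) = sublevel_volume \<phi> I"
    using fin by (simp add: less_top)
  ultimately show ?thesis by (simp only:)
qed

lemma sublevel_volume_four_points:
  assumes I: "finite I" "\<And>k. k \<in> I \<Longrightarrow> young_function (\<phi> k)"
    and "a \<le> b" "b \<le> d" "a + d = b + c"
  shows "sublevel_volume \<phi> I a * sublevel_volume \<phi> I d \<le> sublevel_volume \<phi> I b * sublevel_volume \<phi> I c"
proof -
  let ?V = "\<lambda>s. enn2real (sublevel_volume \<phi> I s)"
  have V: "sublevel_volume \<phi> I s = ennreal (?V s)" for s
    using sublevel_volume_finite[of I \<phi> s, OF I] by (simp add: less_top)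
  have "?V a * ?V d \<le> ?V b * ?V c"
    by (rule log_concave_four_points[OF sublevel_volume_log_concave[OF I] assms(3-5)])
  then show ?thesis by (subst (1 2 3 4) V) (simp add: ennreal_mult[symmetric] ennreal_leI)
qed

section \<open>Two coordinates of a generalized Orlicz ball\<close>

text \<open>
  Up to normalization, the joint density of two coordinates of the ball is the volume of the section that
  remains when they are fixed. It depends on them only through the part
  \<open>\<phi> i \<bar>x\<bar> + \<phi> j \<bar>y\<bar>\<close> of the budget \<open>s\<close> that they use up.
\<close>

lemma nn_integral_sublevel_two_coordinates:
  fixes u v :: "real \<Rightarrow> ennreal"
  assumes J: "finite J" "i \<notin> J" "j \<notin> J" "i \<noteq> j"
    and \<phi>: "\<And>k. k \<in> insert i (insert j J) \<Longrightarrow> young_function (\<phi> k)"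
    and [measurable]: "u \<in> borel_measurable borel" "v \<in> borel_measurable borel"
  shows "(\<integral>\<^sup>+z. u (z i) * v (z j) * indicator {z. (\<Sum>k\<in>insert i (insert j J). \<phi> k \<bar>z k\<bar>) \<le> s} z
           \<partial>PiM (insert i (insert j J)) (\<lambda>_. lborel))
       = (\<integral>\<^sup>+x. \<integral>\<^sup>+y. u x * v y * sublevel_volume \<phi> J (s - \<phi> i \<bar>x\<bar> - \<phi> j \<bar>y\<bar>) \<partial>lborel \<partial>lborel)"
proof -
  interpret product_sigma_finite "\<lambda>_. lborel :: real measure" by (rule product_sigma_finite_lborel)
  let ?I = "insert j J"
  let ?S = "\<lambda>I s. {z. (\<Sum>k\<in>I. \<phi> k \<bar>z k\<bar>) \<le> s}"
  have I: "finite ?I" "i \<notin> ?I" using J by auto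
  note ind = sublevel_indicator_measurable[of _ \<phi>]
  have m1: "(\<lambda>z. u (z i) * v (z j) * indicator (?S (insert i ?I) s) z) \<in> borel_measurable (PiM (insert i ?I) (\<lambda>_. lborel))"
    using ind[of "insert i ?I" s] \<phi> by (intro borel_measurable_times_ennreal) (auto intro!: measurable_compose[of _ _ borel])
  have "(\<integral>\<^sup>+z. u (z i) * v (z j) * indicator (?S (insert i ?I) s) z \<partial>PiM (insert i ?I) (\<lambda>_. lborel))
      = (\<integral>\<^sup>+x. \<integral>\<^sup>+z. u x * v (z j) * indicator (?S ?I (s - \<phi> i \<bar>x\<bar>)) z \<partial>PiM ?I (\<lambda>_. lborel) \<partial>lborel)"
    by (subst product_nn_integral_insert_rev[OF I m1])
       (simp only: indicator_sublevel_fun_upd[OF I] fun_upd_same fun_upd_other[OF J(4)[symmetric]])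
  also have "\<dots> = (\<integral>\<^sup>+x. \<integral>\<^sup>+y. u x * v y * sublevel_volume \<phi> J (s - \<phi> i \<bar>x\<bar> - \<phi> j \<bar>y\<bar>) \<partial>lborel \<partial>lborel)"
  proof (intro nn_integral_cong)
    fix x :: real
    let ?s = "s - \<phi> i \<bar>x\<bar>"
    have m2: "(\<lambda>z. u x * v (z j) * indicator (?S ?I ?s) z) \<in> borel_measurable (PiM ?I (\<lambda>_. lborel))"
      using ind[of ?I ?s] \<phi> by (intro borel_measurable_times_ennreal) (auto intro!: measurable_compose[of _ _ borel])
    have mJ: "(\<lambda>z. indicator (?S J r) z :: ennreal) \<in> borel_measurable (PiM J (\<lambda>_. lborel))" for r
      using ind[of J r] \<phi> by auto
    have "(\<integral>\<^sup>+z. u x * v (z j) * indicator (?S ?I ?s) z \<partial>PiM ?I (\<lambda>_. lborel))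
        = (\<integral>\<^sup>+y. \<integral>\<^sup>+z. u x * v y * indicator (?S J (?s - \<phi> j \<bar>y\<bar>)) z \<partial>PiM J (\<lambda>_. lborel) \<partial>lborel)"
      by (subst product_nn_integral_insert_rev[OF J(1,3) m2])
         (simp only: indicator_sublevel_fun_upd[OF J(1,3)] fun_upd_same)
    also have "\<dots> = (\<integral>\<^sup>+y. u x * v y * sublevel_volume \<phi> J (?s - \<phi> j \<bar>y\<bar>) \<partial>lborel)"
      unfolding sublevel_volume_def by (intro nn_integral_cong nn_integral_cmult mJ)
    finally show "(\<integral>\<^sup>+z. u x * v (z j) * indicator (?S ?I ?s) z \<partial>PiM ?I (\<lambda>_. lborel)) = \<dots>" .
  qed
  finally show ?thesis .
qed

lemma generalized_orlicz_ball_sets: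
  assumes "\<And>i. young_function (\<phi> i)"
  shows "{x :: real ^ 'n. (\<Sum>i\<in>UNIV. \<phi> i \<bar>x $ i\<bar>) \<le> 1} \<in> sets borel"
proof -
  have [measurable]: "(\<lambda>x :: real ^ 'n. \<phi> i \<bar>x $ i\<bar>) \<in> borel_measurable borel" for i
    by (rule measurable_compose[OF _ young_function_measurable[OF assms]]) simp
  have "{x \<in> space borel. (\<Sum>i\<in>UNIV. \<phi> i \<bar>(x :: real ^ 'n) $ i\<bar>) \<le> 1} \<in> sets borel" by measurable
  then show ?thesis by simp
qed

text \<open>
  The coordinates of a vector are indexed here by the standard basis, in which Lebesgue measure is a
  product measure; \<open>\<psi>\<close> is \<open>\<phi>\<close> reindexed accordingly. For \<open>\<bar>x\<bar> \<le> \<bar>x'\<bar>\<close> and \<open>\<bar>y\<bar> \<le> \<bar>y'\<bar>\<close> the budgets left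
  by \<open>(x', y')\<close> and \<open>(x, y)\<close> are the outer points, and those left by the two mixed pairs the inner
  points, of a four-point configuration with equal sums. Log-concavity therefore gives the reverse total
  positivity of the joint density \<open>P\<close>.
\<close>

lemma orlicz_ball_negative_dependence:
  fixes u v :: "real \<Rightarrow> ennreal" and \<phi> :: "'n::finite \<Rightarrow> real \<Rightarrow> real"
  defines "K \<equiv> {x :: real ^ 'n. (\<Sum>i\<in>UNIV. \<phi> i \<bar>x $ i\<bar>) \<le> 1}"
  assumes \<phi>: "\<And>i. young_function (\<phi> i)"
    and [measurable]: "u \<in> borel_measurable borel" "v \<in> borel_measurable borel"
    and u: "\<And>x y. \<bar>x\<bar> \<le> \<bar>y\<bar> \<Longrightarrow> u x \<le> u y"
    and v: "\<And>x y. \<bar>x\<bar> \<le> \<bar>y\<bar> \<Longrightarrow> v x \<le> v y"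
    and ij: "i \<noteq> j"
  shows "(\<integral>\<^sup>+x. u (x $ i) * v (x $ j) * indicator K x \<partial>lborel) * emeasure lborel K
       \<le> (\<integral>\<^sup>+x. u (x $ i) * indicator K x \<partial>lborel) * (\<integral>\<^sup>+x. v (x $ j) * indicator K x \<partial>lborel)"
proof -
  let ?B = "Basis :: (real ^ 'n) set"
  define a where "a = (axis i 1 :: real ^ 'n)"
  define b where "b = (axis j 1 :: real ^ 'n)"
  define \<psi> where "\<psi> k = \<phi> (axis_index k)" for k :: "real ^ 'n"
  define J where "J = ?B - {a, b}"
  have ab: "a \<noteq> b" using ij by (simp add: a_def b_def axis_eq_axis)
  have B: "?B = insert a (insert b J)" by (auto simp: J_def a_def b_def)
  have J: "finite J" "a \<notin> J" "b \<notin> J" by (auto simp: J_def)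
  have \<psi>: "young_function (\<psi> k)" for k by (simp add: \<psi>_def \<phi>)
  have K[measurable]: "K \<in> sets borel" unfolding K_def by (rule generalized_orlicz_ball_sets[OF \<phi>])
  have coord: "(\<Sum>k\<in>?B. z k *\<^sub>R k) $ l = z (axis l 1)" for z l
    using inner_sum_left_Basis[of "axis l 1" z] by (simp add: inner_axis)
  have "bij_betw (\<lambda>l. axis l 1) UNIV ?B" by (auto simp: bij_betw_def inj_on_def axis_eq_axis Basis_vec_def)
  then have "(\<Sum>k\<in>?B. \<psi> k \<bar>z k\<bar>) = (\<Sum>l\<in>UNIV. \<phi> l \<bar>z (axis l 1)\<bar>)" for z
    using sum.reindex_bij_betw[of _ _ _ "\<lambda>k. \<psi> k \<bar>z k\<bar>"] by (fastforce simp: \<psi>_def)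
  then have indK: "indicator K (\<Sum>k\<in>?B. z k *\<^sub>R k) = indicator {z. (\<Sum>k\<in>?B. \<psi> k \<bar>z k\<bar>) \<le> 1} z" for z
    by (simp add: K_def coord indicator_def del: sum_component vector_scaleR_component)
  define P where "P x y = sublevel_volume \<psi> J (1 - \<psi> a \<bar>x\<bar> - \<psi> b \<bar>y\<bar>)" for x y
  have E: "(\<integral>\<^sup>+x. p (x $ i) * q (x $ j) * indicator K x \<partial>lborel) = (\<integral>\<^sup>+x. \<integral>\<^sup>+y. p x * q y * P x y \<partial>lborel \<partial>lborel)"
    if [measurable]: "p \<in> borel_measurable borel" "q \<in> borel_measurable borel" for p q :: "real \<Rightarrow> ennreal"
  proof -
    have "(\<integral>\<^sup>+x. p (x $ i) * q (x $ j) * indicator K x \<partial>lborel)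
        = (\<integral>\<^sup>+z. p (z a) * q (z b) * indicator {z. (\<Sum>k\<in>?B. \<psi> k \<bar>z k\<bar>) \<le> 1} z \<partial>PiM ?B (\<lambda>_. lborel))"
      by (subst lborel_eq, subst nn_integral_distr) (simp_all add: coord indK a_def b_def del: sum_component vector_scaleR_component)
    also have "\<dots> = (\<integral>\<^sup>+x. \<integral>\<^sup>+y. p x * q y * P x y \<partial>lborel \<partial>lborel)"
      unfolding B P_def using J ab \<psi> by (intro nn_integral_sublevel_two_coordinates) auto
    finally show ?thesis .
  qed
  have [measurable]: "sublevel_volume \<psi> J \<in> borel_measurable borel"
    "(\<lambda>x. \<psi> a \<bar>x\<bar>) \<in> borel_measurable borel" "(\<lambda>x. \<psi> b \<bar>x\<bar>) \<in> borel_measurable borel"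
    using J \<psi> by (auto intro: sublevel_volume_measurable young_function_measurable)
  have P: "case_prod P \<in> borel_measurable (borel \<Otimes>\<^sub>M borel)"
    unfolding P_def by measurable
  have PP: "P x y * P x' y' \<le> P x y' * P x' y" if "\<bar>x\<bar> \<le> \<bar>x'\<bar>" "\<bar>y\<bar> \<le> \<bar>y'\<bar>" for x x' y y'
  proof -
    have "\<psi> a \<bar>x\<bar> \<le> \<psi> a \<bar>x'\<bar>" "\<psi> b \<bar>y\<bar> \<le> \<psi> b \<bar>y'\<bar>" using that by (auto intro: young_function_mono[OF \<psi>])
    then have "P x' y' * P x y \<le> P x y' * P x' y"
      unfolding P_def using J \<psi> by (intro sublevel_volume_four_points) auto
    then show ?thesis by (simp add: mult.commute)
  qed
  have "emeasure lborel K = (\<integral>\<^sup>+x. \<integral>\<^sup>+y. P x y \<partial>lborel \<partial>lborel)"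
    using E[of "\<lambda>_. 1" "\<lambda>_. 1"] by simp
  then show ?thesis
    using negative_dependence_nn_integral[OF P _ _ u v PP] E[of u v] E[of u "\<lambda>_. 1"] E[of "\<lambda>_. 1" v] by simp
qed

section \<open>Covariances\<close>

lemma (in prob_space) covariance_shift:
  assumes "integrable M U" "integrable M V" "integrable M (\<lambda>\<omega>. U \<omega> * V \<omega>)"
  shows "covariance M (\<lambda>\<omega>. U \<omega> - c) (\<lambda>\<omega>. V \<omega> - d) = covariance M U V"
  using assms by (simp add: covariance_def left_diff_distrib right_diff_distrib prob_space)

lemma covariance_nonpos_if_nn_integral_le:
  assumes "integrable M U" "integrable M V" "integrable M (\<lambda>\<omega>. U \<omega> * V \<omega>)"
    and nn: "\<And>\<omega>. 0 \<le> U \<omega>" "\<And>\<omega>. 0 \<le> V \<omega>"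
    and le: "(\<integral>\<^sup>+\<omega>. ennreal (U \<omega>) * ennreal (V \<omega>) \<partial>M) \<le> (\<integral>\<^sup>+\<omega>. U \<omega> \<partial>M) * (\<integral>\<^sup>+\<omega>. V \<omega> \<partial>M)"
  shows "covariance M U V \<le> 0"
proof -
  have "ennreal (LINT \<omega>|M. U \<omega> * V \<omega>) \<le> ennreal (LINT \<omega>|M. U \<omega>) * ennreal (LINT \<omega>|M. V \<omega>)"
    using le assms(1-3) nn by (simp add: nn_integral_eq_integral ennreal_mult[symmetric])
  then show ?thesis using nn
    by (simp add: covariance_def ennreal_mult[symmetric] integral_nonneg_AE)
qed

theorem corollary3p2:
  fixes K :: "(real ^ 'n) set"
    and M :: "'a measure"
    and X :: "'a \<Rightarrow> real ^ 'n"
    and f g :: "real \<Rightarrow> real"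
    and i j :: 'n
  assumes "CARD('n) \<ge> 2"
    and "generalized_orlicz_ball K"
    and "isotropic_position K"
    and "prob_space M"
    and "X \<in> borel_measurable M"
    and "distr M lborel X = uniform_measure lborel K"
    and "\<And>x. f (- x) = f x" and "mono_on {0..} f"
    and "\<And>x. g (- x) = g x" and "mono_on {0..} g"
    and "i \<noteq> j"
  shows "covariance M (\<lambda>\<omega>. f (X \<omega> $ i)) (\<lambda>\<omega>. g (X \<omega> $ j)) \<le> 0"
proof -
  interpret prob_space M by fact
  note X[measurable] = \<open>X \<in> borel_measurable M\<close>
  obtain \<phi> where \<phi>: "\<And>k. young_function (\<phi> k)" and K_eq: "K = {x. (\<Sum>k\<in>UNIV. \<phi> k \<bar>x $ k\<bar>) \<le> 1}"
    using assms(2) by (auto simp: generalized_orlicz_ball_def)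
  have K[measurable]: "K \<in> sets borel" unfolding K_eq by (rule generalized_orlicz_ball_sets[OF \<phi>])
  have vol: "emeasure lborel K = 1" using assms(3) by (simp add: isotropic_position_def)
  have E: "(\<integral>\<^sup>+\<omega>. h (X \<omega>) \<partial>M) = (\<integral>\<^sup>+x. h x * indicator K x \<partial>lborel)"
    if [measurable]: "h \<in> borel_measurable borel" for h :: "real ^ 'n \<Rightarrow> ennreal"
  proof -
    have "(\<integral>\<^sup>+\<omega>. h (X \<omega>) \<partial>M) = (\<integral>\<^sup>+x. h x \<partial>distr M lborel X)"
      by (subst nn_integral_distr) auto
    also have "\<dots> = (\<integral>\<^sup>+x. h x * indicator K x \<partial>lborel)"
      unfolding assms(6) by (subst nn_integral_uniform_measure) (auto simp: vol divide_ennreal_def)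
    finally show ?thesis .
  qed
  have XK: "AE \<omega> in M. X \<omega> \<in> K"
  proof -
    have "AE x in distr M lborel X. x \<in> K" unfolding assms(6) by (rule AE_uniform_measureI) auto
    then show ?thesis by (subst (asm) AE_distr_iff) auto
  qed
  (* The ball is bounded in each direction, as a coordinate beyond R uses up more than the
     budget 1. So an even function that is monotone in the modulus is bounded on it. *)
  have bounded: "\<exists>C. AE \<omega> in M. \<bar>h (X \<omega> $ k)\<bar> \<le> C"
    if even: "\<And>x. h (- x) = h x" and mono: "mono_on {0..} h" for h :: "real \<Rightarrow> real" and k
  proof -
    obtain R where R: "0 \<le> R" "\<And>x. R < x \<Longrightarrow> 1 < \<phi> k x" using young_function_unbounded[OF \<phi>] by blast
    have "\<bar>h (x $ k)\<bar> \<le> \<bar>h 0\<bar> + \<bar>h R\<bar>" if "x \<in> K" for x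
    proof -
      have "\<phi> k \<bar>x $ k\<bar> \<le> (\<Sum>l\<in>UNIV. \<phi> l \<bar>x $ l\<bar>)"
        by (rule member_le_sum) (auto simp: young_function_nonneg[OF \<phi>])
      also have "\<dots> \<le> 1" using that by (simp add: K_eq)
      finally have "\<bar>x $ k\<bar> \<le> R" using R(2)[of "\<bar>x $ k\<bar>"] by linarith
      then have "h 0 \<le> h \<bar>x $ k\<bar>" "h \<bar>x $ k\<bar> \<le> h R" using mono R(1) by (auto simp: mono_on_def)
      moreover have "h \<bar>x $ k\<bar> = h (x $ k)" using even by (simp add: abs_if)
      ultimately show ?thesis by linarith
    qed
    then show ?thesis using XK by (intro exI[of _ "\<bar>h 0\<bar> + \<bar>h R\<bar>"]) (auto elim: eventually_mono)
  qed
  have even_abs: "f \<bar>x\<bar> = f x" "g \<bar>x\<bar> = g x" for x using assms(7,9) by (auto simp: abs_if)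
  have [measurable]: "f \<in> borel_measurable borel" "g \<in> borel_measurable borel"
    using borel_measurable_abs_mono_on[OF assms(8)] borel_measurable_abs_mono_on[OF assms(10)] by (simp_all add: even_abs)
  have mono_abs: "f x \<le> f y" "g x \<le> g y" if "\<bar>x\<bar> \<le> \<bar>y\<bar>" for x y
    using mono_onD[OF assms(8), of "\<bar>x\<bar>" "\<bar>y\<bar>"] mono_onD[OF assms(10), of "\<bar>x\<bar>" "\<bar>y\<bar>"] that by (simp_all add: even_abs)
  let ?U = "\<lambda>\<omega>. f (X \<omega> $ i)" and ?V = "\<lambda>\<omega>. g (X \<omega> $ j)"
  obtain C D where C: "AE \<omega> in M. \<bar>?U \<omega>\<bar> \<le> C" and D: "AE \<omega> in M. \<bar>?V \<omega>\<bar> \<le> D"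
    using bounded[OF assms(7,8)] bounded[OF assms(9,10)] by metis
  have coord[measurable]: "(\<lambda>\<omega>. X \<omega> $ k) \<in> borel_measurable M" for k
    by (rule measurable_compose[OF X]) simp
  have [measurable]: "?U \<in> borel_measurable M" "?V \<in> borel_measurable M"
    by measurable
  have intU: "integrable M ?U" using C by (intro integrable_const_bound[where B = C]) auto
  have intV: "integrable M ?V" using D by (intro integrable_const_bound[where B = D]) auto
  have "AE \<omega> in M. \<bar>?U \<omega> * ?V \<omega>\<bar> \<le> C * D"
    using C D by eventually_elim (auto simp: abs_mult intro!: mult_mono)
  then have intUV: "integrable M (\<lambda>\<omega>. ?U \<omega> * ?V \<omega>)"
    by (intro integrable_const_bound[where B = "C * D"]) auto
  (* Subtracting the minima, attained at 0, makes both functions nonnegative, so that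
     nonnegative integrals apply. *)
  have "covariance M (\<lambda>\<omega>. ?U \<omega> - f 0) (\<lambda>\<omega>. ?V \<omega> - g 0) \<le> 0"
  proof (rule covariance_nonpos_if_nn_integral_le)
    show "integrable M (\<lambda>\<omega>. (?U \<omega> - f 0) * (?V \<omega> - g 0))"
      using intU intV intUV by (simp add: left_diff_distrib right_diff_distrib)
    show "0 \<le> ?U \<omega> - f 0" "0 \<le> ?V \<omega> - g 0" for \<omega> using mono_abs[of 0] by auto
    let ?u = "\<lambda>x. ennreal (f x - f 0)" and ?v = "\<lambda>x. ennreal (g x - g 0)"
    have "(\<integral>\<^sup>+x. ?u (x $ i) * ?v (x $ j) * indicator K x \<partial>lborel) * emeasure lborel K
       \<le> (\<integral>\<^sup>+x. ?u (x $ i) * indicator K x \<partial>lborel) * (\<integral>\<^sup>+x. ?v (x $ j) * indicator K x \<partial>lborel)"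
      unfolding K_eq using mono_abs \<open>i \<noteq> j\<close>
      by (intro orlicz_ball_negative_dependence[OF \<phi>]) (auto intro!: ennreal_leI)
    then show "(\<integral>\<^sup>+\<omega>. ?u (X \<omega> $ i) * ?v (X \<omega> $ j) \<partial>M) \<le> (\<integral>\<^sup>+\<omega>. ?u (X \<omega> $ i) \<partial>M) * (\<integral>\<^sup>+\<omega>. ?v (X \<omega> $ j) \<partial>M)"
      using E[of "\<lambda>x. ?u (x $ i) * ?v (x $ j)"] E[of "\<lambda>x. ?u (x $ i)"] E[of "\<lambda>x. ?v (x $ j)"] by (simp add: vol)
  qed (use intU intV in auto)
  then show ?thesis by (simp add: covariance_shift intU intV intUV)
qed

end
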